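(* (Right piece local cover theorem) Let $U$ be a right $i$-piece in the bottom-left packing of the subinstance $\mathcal{I}_i$ consisting of the first $i$ squares. Then $U$ can be covered by at most four copies of the squares adjacent to $U$; that is, there is a family of translates of squares adjacent to $U$, each used at most four times, whose union contains $U$.
   Context: Consider an instance of the Square Strip Packing Problem with strip width $W$ and an ordering $S_1,\dots,S_n$ with its bottom-left packing (each square in turn is placed, without overlapping interiors and inside $[0,W]\times[0,\infty)$, at the feasible position $(x,y)$ with $(y,x)$ lexicographically minimal). Squares are closed sets. $\mathcal{I}_i$ is the subinstance consisting of $S_1,\dots,S_i$. $i$-pieces: inductively for $i=1,\dots,n$, the $i$-pieces are the bounded connected components of $([0,W]\times[0,\infty))\setminus\big(\bigcup_{j\le i}S_j\cup\bigcup\{\text{$k$-pieces},\,k<i\}\big)$. A square $S$ is adjacent to a piece $U$ if $\overline U\cap S\ne\varnothing$. A piece is a right piece if its closure meets the right strip boundary $\{W\}\times\mathbb{R}_{\ge0}$. *)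

theory Defs
  imports "HOL-Analysis.Analysis"
begin

type_synonym point = "real \<times> real"

definition sq :: "point \<Rightarrow> real \<Rightarrow> point set" where
  "sq p a = {fst p .. fst p + a} \<times> {snd p .. snd p + a}"

definition strip :: "real \<Rightarrow> point set" where
  "strip W = {0..W} \<times> {0..}"

definition feasible :: "real \<Rightarrow> (nat \<Rightarrow> real) \<Rightarrow> (nat \<Rightarrow> point) \<Rightarrow> nat \<Rightarrow> point \<Rightarrow> bool" where
  "feasible W s p k q \<longleftrightarrow> sq q (s k) \<subseteq> strip W \<and>
     (\<forall>j\<in>{1..<k}. interior (sq (p j) (s j)) \<inter> interior (sq q (s k)) = {})"

definition is_BL_packing :: "real \<Rightarrow> (nat \<Rightarrow> real) \<Rightarrow> nat \<Rightarrow> (nat \<Rightarrow> point) \<Rightarrow> bool" where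
  "is_BL_packing W s n p \<longleftrightarrow> (\<forall>k\<in>{1..n}. feasible W s p k (p k) \<and>
     (\<forall>q. feasible W s p k q \<longrightarrow>
        snd (p k) < snd q \<or> (snd (p k) = snd q \<and> fst (p k) \<le> fst q)))"

definition new_pieces :: "real \<Rightarrow> (nat \<Rightarrow> real) \<Rightarrow> (nat \<Rightarrow> point) \<Rightarrow> nat \<Rightarrow> point set set \<Rightarrow> point set set" where
  "new_pieces W s p i P = {C \<in> components (strip W - ((\<Union>j\<in>{1..i}. sq (p j) (s j)) \<union> \<Union>P)). bounded C}"

primrec pieces_before :: "real \<Rightarrow> (nat \<Rightarrow> real) \<Rightarrow> (nat \<Rightarrow> point) \<Rightarrow> nat \<Rightarrow> point set set" where
  "pieces_before W s p 0 = {}"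
| "pieces_before W s p (Suc i) = pieces_before W s p i \<union> new_pieces W s p i (pieces_before W s p i)"

definition pieces :: "real \<Rightarrow> (nat \<Rightarrow> real) \<Rightarrow> (nat \<Rightarrow> point) \<Rightarrow> nat \<Rightarrow> point set set" where
  "pieces W s p i = new_pieces W s p i (pieces_before W s p i)"

definition adjacent :: "point set \<Rightarrow> point set \<Rightarrow> bool" where
  "adjacent S U \<longleftrightarrow> closure U \<inter> S \<noteq> {}"

definition right_piece :: "real \<Rightarrow> point set \<Rightarrow> bool" where
  "right_piece W U \<longleftrightarrow> closure U \<inter> ({W} \<times> {0..}) \<noteq> {}"

end

theory Submission
  imports Defs
begin

text \<open>The four copies of a square of side \<open>s\<close> are its translates by \<open>(s, 0)\<close>, \<open>(0, -s)\<close>, \<open>(s, -s)\<close>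
  and \<open>(2s, -s)\<close>. Let \<open>(x, v)\<close> be a point of the piece and \<open>t\<close> the square hit first when going up
  from it. Every square rests on a chain of earlier squares leading down to the floor; hence
  \<open>t\<close> rests on squares to the left of the column above \<open>(x, v)\<close> (otherwise the column would have been
  cut off from infinity too early), and a square that is visible from the column in some row stays
  visible up to its top. Suppose that \<open>(x, v)\<close> is not covered. Then every visible square with top
  \<open>T\<close> and right side \<open>R\<close> satisfies \<open>T - v < x - R\<close>, by induction on \<open>T\<close>: if its bottom lies above \<open>v\<close>,
  then it did not fit directly to the left of the column at a slightly lower height, which yields a
  lower visible square, with top \<open>T'\<close> not below that bottom and with right side \<open>R'\<close> at distance
  \<open>x - R' < s\<close> from the column, and \<open>T' - v < x - R' < s\<close> bounds the height of the bottom over \<open>v\<close>.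
  Applied to a visible square on which \<open>t\<close> rests, the inequality shows that \<open>t\<close> moved down by its own
  side covers \<open>(x, v)\<close>.\<close>

section \<open>Real numbers: avoiding finite sets and intermediate values\<close>

lemma ex_between_avoiding:
  fixes a b :: real
  assumes "finite F" "a < b"
  obtains y where "a < y" "y < b" "y \<notin> F"
proof -
  have "infinite ({a<..<b} - F)"
    using assms by (simp add: infinite_Ioo)
  then obtain y where "y \<in> {a<..<b} - F"
    by (metis finite.emptyI ex_in_conv)
  with that show ?thesis by auto
qed

text \<open>No element of \<open>F\<close> lies strictly between \<open>b\<close> and
  \<open>c\<close>. Moving a square from \<open>c\<close> to \<open>b\<close> thus passes no
  critical coordinate, and contacts are found without a limit argument.\<close>

lemma ex_bound_below:
  fixes a c :: real
  assumes "finite F" "a < c"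
  shows "\<exists>b\<ge>a. b < c \<and> (\<forall>f\<in>F. f < c \<longrightarrow> f \<le> b)"
proof -
  define b where "b = Max (insert a {f \<in> F. f < c})"
  have "a \<le> b" "\<forall>f\<in>F. f < c \<longrightarrow> f \<le> b"
    using assms(1) by (simp_all add: b_def)
  moreover have "b < c"
    unfolding b_def using assms by (subst Max_less_iff) auto
  ultimately show ?thesis by blast
qed

text \<open>The intermediate value theorem, read downwards: a path given as a function of height
  cannot change sides of a vertical line without meeting it.\<close>

lemma stays_less:
  fixes \<phi> :: "real \<Rightarrow> real"
  assumes "continuous_on UNIV \<phi>" "y \<le> y'" "\<phi> y' < d" "\<And>b. y \<le> b \<Longrightarrow> b \<le> y' \<Longrightarrow> \<phi> b \<noteq> d"
  shows "\<phi> y < d"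
proof (rule ccontr)
  assume "\<not> \<phi> y < d"
  moreover have "continuous_on {y..y'} \<phi>"
    using assms(1) continuous_on_subset by blast
  ultimately show False
    using IVT2'[of \<phi> y' d y] assms by fastforce
qed

lemma stays_greater:
  fixes \<phi> :: "real \<Rightarrow> real"
  assumes "continuous_on UNIV \<phi>" "y \<le> y'" "d < \<phi> y'" "\<And>b. y \<le> b \<Longrightarrow> b \<le> y' \<Longrightarrow> \<phi> b \<noteq> d"
  shows "d < \<phi> y"
  using stays_less[of "\<lambda>b. - \<phi> b" y y' "- d"] assms by (auto intro: continuous_on_minus)

lemma interior_sq_Int_eq_empty:
  "interior (sq q a) \<inter> interior (sq q' a') = {} \<longleftrightarrow>
     \<not> (max (fst q) (fst q') < min (fst q + a) (fst q' + a') \<and>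
        max (snd q) (snd q') < min (snd q + a) (snd q' + a'))"
  by (auto simp: sq_def interior_Times Times_Int_Times Int_greaterThanLessThan not_less)

section \<open>Bottom-left packings: blockers, supports and left contacts\<close>

locale bl_packing =
  fixes W :: real and s :: "nat \<Rightarrow> real" and n :: nat and p :: "nat \<Rightarrow> point"
  assumes W_pos: "W > 0"
    and sizes: "\<And>k. k \<in> {1..n} \<Longrightarrow> 0 < s k \<and> s k \<le> W"
    and packing: "is_BL_packing W s n p"
begin

abbreviation L :: "nat \<Rightarrow> real" where "L k \<equiv> fst (p k)"
abbreviation B :: "nat \<Rightarrow> real" where "B k \<equiv> snd (p k)"
abbreviation R :: "nat \<Rightarrow> real" where "R k \<equiv> fst (p k) + s k"
abbreviation T :: "nat \<Rightarrow> real" where "T k \<equiv> snd (p k) + s k"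

definition E :: "nat \<Rightarrow> point set" where
  "E k = (\<Union>j\<in>{1..k}. sq (p j) (s j))"

lemma mem_E_iff:
  "(x, y) \<in> E k \<longleftrightarrow> (\<exists>j\<in>{1..k}. L j \<le> x \<and> x \<le> R j \<and> B j \<le> y \<and> y \<le> T j)"
  by (auto simp: E_def sq_def)

lemma closed_E: "closed (E k)"
  unfolding E_def sq_def by (intro closed_UN closed_Times ballI finite_atLeastAtMost closed_atLeastAtMost)

lemma E_mono: "j \<le> k \<Longrightarrow> E j \<subseteq> E k"
  unfolding E_def by (intro UN_mono) auto

lemma feasible_iff:
  assumes "k \<in> {1..n}"
  shows "feasible W s p k q \<longleftrightarrow>
     0 \<le> fst q \<and> fst q + s k \<le> W \<and> 0 \<le> snd q \<and>
     (\<forall>j\<in>{1..<k}. \<not> (L j < fst q + s k \<and> fst q < R j \<and> B j < snd q + s k \<and> snd q < T j))"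
proof -
  have pos: "\<And>j. j \<in> {1..k} \<Longrightarrow> 0 < s j"
    using assms sizes by auto
  have "sq q (s k) \<subseteq> strip W \<longleftrightarrow> 0 \<le> fst q \<and> fst q + s k \<le> W \<and> 0 \<le> snd q"
    using pos[of k] assms by (auto simp: sq_def strip_def times_subset_iff)
  moreover have "interior (sq (p j) (s j)) \<inter> interior (sq q (s k)) = {} \<longleftrightarrow>
      \<not> (L j < fst q + s k \<and> fst q < R j \<and> B j < snd q + s k \<and> snd q < T j)"
    if "j \<in> {1..<k}" for j
    using pos[of k] pos[of j] assms that by (auto simp: interior_sq_Int_eq_empty)
  ultimately show ?thesis
    unfolding feasible_def by auto
qed

lemma feasible_p:
  assumes "k \<in> {1..n}"
  shows "feasible W s p k (p k)"
  using packing assms by (auto simp: is_BL_packing_def)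

lemma lex_minimal:
  assumes "k \<in> {1..n}" "feasible W s p k q"
  shows "B k < snd q \<or> B k = snd q \<and> L k \<le> fst q"
  using packing assms by (auto simp: is_BL_packing_def)

lemma in_strip:
  assumes "k \<in> {1..n}"
  shows "0 \<le> L k" "R k \<le> W" "0 \<le> B k"
  using feasible_p[OF assms] feasible_iff[OF assms] by auto

lemma disjoint:
  assumes "j \<in> {1..n}" "k \<in> {1..n}" "j \<noteq> k"
  shows "\<not> (L j < R k \<and> L k < R j \<and> B j < T k \<and> B k < T j)"
proof -
  have *: "\<not> (L j < R k \<and> L k < R j \<and> B j < T k \<and> B k < T j)" if "k \<in> {1..n}" "j \<in> {1..<k}" for j k
    using feasible_p[OF that(1)] feasible_iff[OF that(1), of "p k"] that(2) by simp
  show ?thesis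
    using *[of k j] *[of j k] assms by (cases "j < k") auto
qed

text \<open>The form in which the bottom-left rule is used: a better position inside the strip can
  only fail because of an earlier square.\<close>

lemma blocked_if_lex_smaller:
  assumes "k \<in> {1..n}" "0 \<le> a" "a + s k \<le> W" "0 \<le> b" "b < B k \<or> b = B k \<and> a < L k"
  obtains j where "j \<in> {1..<k}" "L j < a + s k" "a < R j" "B j < b + s k" "b < T j"
proof -
  have "\<not> feasible W s p k (a, b)"
    using lex_minimal[OF assms(1), of "(a, b)"] assms(5) by auto
  then show ?thesis
    using feasible_iff[OF assms(1), of "(a, b)"] assms(2-4) that by fastforce
qed

lemma not_inside_other:
  assumes "j \<in> {1..n}" "k \<in> {1..n}" "j \<noteq> k"
    and "L j \<le> a" "a \<le> R j" "B j \<le> b" "b \<le> T j"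
  shows "\<not> (L k < a \<and> a < R k \<and> B k < b \<and> b < T k)"
proof
  assume "L k < a \<and> a < R k \<and> B k < b \<and> b < T k"
  then have "L j < R k" "L k < R j" "B j < T k" "B k < T j"
    using assms(4-7) by auto
  then show False
    using disjoint[OF assms(1-3)] by blast
qed

text \<open>Lower square \<open>k\<close> to a height \<open>b\<close> that no earlier top separates
  from \<open>B k\<close>. The blocker does not overlap \<open>k\<close> in its true position, so
  its top is at most \<open>B k\<close>; it exceeds \<open>b\<close>, so it equals
  \<open>B k\<close>.\<close>

lemma ex_support:
  assumes k: "k \<in> {1..n}" and "B k > 0"
  obtains c where "c \<in> {1..<k}" "T c = B k" "L c < R k" "L k < R c"
proof -
  obtain b where b: "0 \<le> b" "b < B k"
    and b_max: "\<forall>f\<in>(\<lambda>j. T j) ` {1..<k}. f < B k \<longrightarrow> f \<le> b"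
    using ex_bound_below[OF _ assms(2), of "(\<lambda>j. T j) ` {1..<k}"] by blast
  obtain j where j: "j \<in> {1..<k}" "L j < R k" "L k < R j" "B j < b + s k" "b < T j"
    by (rule blocked_if_lex_smaller[OF k, of "L k" b]) (use in_strip[OF k] b in simp_all)
  have "\<not> (L j < R k \<and> L k < R j \<and> B j < T k \<and> B k < T j)"
    using disjoint[of j k] j(1) k by simp
  then have "T j \<le> B k"
    using j b by linarith
  moreover have "\<not> T j < B k"
    using b_max j(1,5) by fastforce
  ultimately have "T j = B k" by simp
  with that j show ?thesis by blast
qed

text \<open>The argument for supports with a shift to the left: now the right side of the blocker is
  forced to equal \<open>L k\<close>.\<close>

lemma ex_left_contact:
  assumes k: "k \<in> {1..n}" and "L k > 0"
  obtains c where "c \<in> {1..<k}" "R c = L k" "B c < T k" "B k < T c"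
proof -
  obtain b where b: "0 \<le> b" "b < L k"
    and b_max: "\<forall>f\<in>(\<lambda>j. R j) ` {1..<k}. f < L k \<longrightarrow> f \<le> b"
    using ex_bound_below[OF _ assms(2), of "(\<lambda>j. R j) ` {1..<k}"] by blast
  have bW: "b + s k \<le> W"
    using in_strip[OF k] b by linarith
  obtain j where j: "j \<in> {1..<k}" "L j < b + s k" "b < R j" "B j < T k" "B k < T j"
    by (rule blocked_if_lex_smaller[OF k, of b "B k"]) (use bW in_strip[OF k] b in simp_all)
  have "\<not> (L j < R k \<and> L k < R j \<and> B j < T k \<and> B k < T j)"
    using disjoint[of j k] j(1) k by simp
  then have "R j \<le> L k"
    using j b by linarith
  moreover have "\<not> R j < L k"
    using b_max j(1,3) by fastforce
  ultimately have "R j = L k" by simp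
  with that j show ?thesis by blast
qed

section \<open>Descents to the floor and enclosure\<close>

text \<open>A path to the floor inside squares, with abscissa a function of height. The bound
  \<open>T j \<le> B k\<close> serves to show that a descent misses a given square. Continuity on
  the whole line makes the two sides of the path open sets.\<close>

definition descent :: "nat \<Rightarrow> real \<Rightarrow> (real \<Rightarrow> real) \<Rightarrow> bool" where
  "descent k y \<phi> \<longleftrightarrow> continuous_on UNIV \<phi> \<and>
     (\<forall>b\<in>{0..y}. \<exists>j\<in>{1..k}. (j = k \<or> T j \<le> B k) \<and>
        L j \<le> \<phi> b \<and> \<phi> b \<le> R j \<and> B j \<le> b \<and> b \<le> T j)"

lemma descent_in_E: "descent k y \<phi> \<Longrightarrow> 0 \<le> b \<Longrightarrow> b \<le> y \<Longrightarrow> (\<phi> b, b) \<in> E k"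
  unfolding descent_def mem_E_iff by (metis atLeastAtMost_iff)

text \<open>Up to height \<open>B k\<close> the path is \<open>\<psi>\<close>; above it is the
  straight segment from \<open>(a', B k)\<close> to \<open>(a, y)\<close>, which lies in square
  \<open>k\<close> by convexity.\<close>

lemma descent_extend:
  assumes k: "k \<in> {1..n}" and c: "c \<in> {1..<k}" "T c = B k"
    and \<psi>: "descent c (B k) \<psi>" "\<psi> (B k) = a'" "L k \<le> a'" "a' \<le> R k"
    and a: "L k \<le> a" "a \<le> R k" and y: "B k < y" "y \<le> T k"
  obtains \<phi> where "descent k y \<phi>" "\<phi> y = a" "\<phi> (B k) = a'"
proof -
  define h where "h b = a' + (a - a') * ((b - B k) / (y - B k))" for b
  define \<phi> where "\<phi> b = (if b \<le> B k then \<psi> b else h b)" for b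
  have \<psi>_cont: "continuous_on UNIV \<psi>"
    using \<psi>(1) by (simp add: descent_def)
  have "continuous_on ({..B k} \<union> {B k..}) \<phi>"
    unfolding \<phi>_def
  proof (rule continuous_on_cases)
    show "continuous_on {..B k} \<psi>"
      using \<psi>_cont continuous_on_subset by blast
    show "continuous_on {B k..} h"
      unfolding h_def using y by (intro continuous_intros) auto
    show "\<forall>b. b \<in> {..B k} \<and> \<not> b \<le> B k \<or> b \<in> {B k..} \<and> b \<le> B k \<longrightarrow> \<psi> b = h b"
      using \<psi>(2) by (auto simp: h_def)
  qed auto
  moreover have "{..B k} \<union> {B k..} = (UNIV :: real set)"
    by auto
  ultimately have "continuous_on UNIV \<phi>" by simp
  moreover have "\<exists>j\<in>{1..k}. (j = k \<or> T j \<le> B k) \<and> L j \<le> \<phi> b \<and> \<phi> b \<le> R j \<and> B j \<le> b \<and> b \<le> T j"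
    if b: "b \<in> {0..y}" for b
  proof (cases "b \<le> B k")
    case True
    then have "b \<in> {0..B k}" using b by simp
    then obtain j where j: "j \<in> {1..c}" "j = c \<or> T j \<le> B c"
      "L j \<le> \<psi> b" "\<psi> b \<le> R j" "B j \<le> b" "b \<le> T j"
      using \<psi>(1) unfolding descent_def by blast
    moreover have "s c > 0"
      using sizes c k by auto
    ultimately show ?thesis
      using True c by (intro bexI[of _ j]) (auto simp: \<phi>_def)
  next
    case False
    define r where "r = (b - B k) / (y - B k)"
    have r: "0 \<le> r" "r \<le> 1"
      using False b y by (auto simp: r_def)
    have eq: "\<phi> b = (1 - r) * a' + r * a"
      using False by (simp add: \<phi>_def h_def r_def[symmetric]) (simp add: algebra_simps)
    have "\<phi> b \<in> {L k..R k}"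
      unfolding eq using r a \<psi> convexD[of "{L k..R k}" a' a "1 - r" r] by auto
    then show ?thesis
      using False b y k by (intro bexI[of _ k]) auto
  qed
  ultimately have "descent k y \<phi>"
    by (simp add: descent_def)
  moreover have "\<phi> y = a" "\<phi> (B k) = a'"
    using y \<psi>(2) by (auto simp: \<phi>_def h_def)
  ultimately show ?thesis using that by blast
qed

text \<open>Supports have smaller indices, so following them ends at a square standing on the floor,
  where a vertical line suffices.\<close>

lemma ex_descent:
  assumes "k \<in> {1..n}" "L k \<le> a" "a \<le> R k" "B k < y" "y \<le> T k"
  shows "\<exists>\<phi>. descent k y \<phi> \<and> \<phi> y = a"
  using assms
proof (induction k arbitrary: a y rule: less_induct)
  case (less k)
  show ?case
  proof (cases "B k = 0")
    case True
    then show ?thesis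
      using less.prems by (intro exI[of _ "\<lambda>_. a"]) (auto simp: descent_def intro!: bexI[of _ k])
  next
    case False
    then have "B k > 0" using in_strip[OF less.prems(1)] by auto
    then obtain c where c: "c \<in> {1..<k}" "T c = B k" "L c < R k" "L k < R c"
      using ex_support less.prems(1) by blast
    have c': "c \<in> {1..n}" "s c > 0" using c less.prems(1) sizes by auto
    define a' where "a' = max (L c) (L k)"
    have "s k > 0" using sizes less.prems(1) by blast
    then have a': "L c \<le> a'" "a' \<le> R c" "L k \<le> a'" "a' \<le> R k"
      using c c' by (auto simp: a'_def)
    obtain \<psi> where "descent c (B k) \<psi>" "\<psi> (B k) = a'"
      using less.IH[of c a' "B k"] c c' a' by auto
    then show ?thesis
      using descent_extend[OF less.prems(1) c(1,2) _ _ a'(3,4) less.prems(2-5)] by metis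
  qed
qed

text \<open>Lets the support be prescribed: where the path enters \<open>k\<close> will decide on
  which side of a column it passes.\<close>

lemma ex_descent_via:
  assumes "k \<in> {1..n}" "L k \<le> a" "a \<le> R k" "B k < y" "y \<le> T k"
    and c: "c \<in> {1..<k}" "T c = B k" "L c < R k" "L k < R c"
  obtains \<phi> a' where "descent k y \<phi>" "\<phi> y = a" "\<phi> (B k) = a'" "L c \<le> a'" "a' \<le> R c"
proof -
  have c': "c \<in> {1..n}" "s c > 0" using c assms(1) sizes by auto
  define a' where "a' = max (L c) (L k)"
  have "s k > 0" using sizes assms(1) by blast
  then have a': "L c \<le> a'" "a' \<le> R c" "L k \<le> a'" "a' \<le> R k"
    using c c' by (auto simp: a'_def)
  obtain \<psi> where "descent c (B k) \<psi>" "\<psi> (B k) = a'"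
    using ex_descent[of c a' "B k"] c c' a' by auto
  then show ?thesis
    using descent_extend[OF assms(1) c(1,2) _ _ a'(3,4) assms(2-5)] a' that by metis
qed

text \<open>The region below height \<open>y\<close> between the two paths has its sides and its lid
  outside \<open>strip W - E k\<close>, and the strip has no points below the floor. Hence its open
  inside \<open>I\<close> and open outside \<open>O'\<close> cover \<open>C\<close>, and a connected
  \<open>C\<close> meeting \<open>I\<close> stays in it.\<close>

lemma enclosed:
  assumes cont: "continuous_on UNIV \<phi>" "continuous_on UNIV \<psi>"
    and lside: "\<And>b. 0 \<le> b \<Longrightarrow> b \<le> y \<Longrightarrow> (\<phi> b, b) \<notin> strip W - E k"
    and rside: "\<And>b. 0 \<le> b \<Longrightarrow> b \<le> y \<Longrightarrow> (\<psi> b, b) \<notin> strip W - E k"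
    and lid: "\<And>a. \<phi> y < a \<Longrightarrow> a < \<psi> y \<Longrightarrow> (a, y) \<notin> strip W - E k"
    and C: "connected C" "C \<subseteq> strip W - E k"
    and z: "z \<in> C" "snd z < y" "\<phi> (snd z) < fst z" "fst z < \<psi> (snd z)"
    and w: "w \<in> C"
  shows "snd w < y \<and> \<phi> (snd w) < fst w \<and> fst w < \<psi> (snd w)"
proof -
  define I where "I = {w. snd w < y} \<inter> {w. \<phi> (snd w) < fst w} \<inter> {w. fst w < \<psi> (snd w)}"
  define O' where "O' = {w. y < snd w} \<union> {w. fst w < \<phi> (snd w)} \<union> {w. \<psi> (snd w) < fst w}"
  have cont2: "continuous_on UNIV (\<lambda>w::point. \<phi> (snd w))" "continuous_on UNIV (\<lambda>w::point. \<psi> (snd w))"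
    by (intro continuous_on_compose2[OF cont(1)] continuous_on_compose2[OF cont(2)] continuous_intros subset_UNIV)+
  have "open I" "open O'"
    unfolding I_def O'_def
    by (intro open_Int open_Un open_Collect_less cont2 continuous_intros)+
  moreover have "I \<inter> O' \<inter> C = {}"
    by (auto simp: I_def O'_def)
  moreover have "C \<subseteq> I \<union> O'"
  proof
    fix c assume "c \<in> C"
    obtain a b where ab: "c = (a, b)" by (cases c)
    have "(a, b) \<in> strip W - E k" and "0 \<le> b"
      using \<open>c \<in> C\<close> C(2) ab by (auto simp: strip_def)
    moreover from this have "a \<noteq> \<phi> b" "a \<noteq> \<psi> b" if "b \<le> y"
      using lside[of b] rside[of b] that by auto
    ultimately show "c \<in> I \<union> O'"
      using lid[of a] ab
      by (cases b y rule: linorder_cases) (auto simp: I_def O'_def not_less neq_iff)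
  qed
  moreover have "I \<inter> C \<noteq> {}"
    using z by (auto simp: I_def)
  ultimately have "C \<subseteq> I"
    using connectedD[OF C(1), of I O'] by auto
  with w show ?thesis by (auto simp: I_def)
qed

end

section \<open>Visibility from a column and the covering estimate\<close>

text \<open>Separates the covering estimate from the topology of pieces; \<open>left_support\<close>
  and \<open>square_to_left\<close> will come from enclosure arguments.\<close>

locale column = bl_packing +
  fixes i t :: nat and x v :: real
  assumes i_le: "i \<le> n"
    and t: "t \<in> {1..i}" "L t < x" "x < R t" "v < B t"
    and v_nonneg: "0 \<le> v"
    and free: "\<And>y. v \<le> y \<Longrightarrow> y < B t \<Longrightarrow> (x, y) \<notin> E i"
    and left_support: "\<exists>c\<in>{1..i}. T c = B t \<and> L t < R c \<and> R c < x"
    and square_to_left: "\<And>y. v \<le> y \<Longrightarrow> y < B t \<Longrightarrow> \<exists>j\<in>{1..i}. R j < x \<and> B j \<le> y \<and> y \<le> T j"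
begin

lemma in_n: "j \<in> {1..i} \<Longrightarrow> j \<in> {1..n}"
  using i_le by auto

definition generic :: "real \<Rightarrow> bool" where
  "generic y \<longleftrightarrow> y \<notin> B ` {1..i} \<union> T ` {1..i}"

text \<open>\<open>k\<close> is the first square met when looking to the left from \<open>(x, y)\<close>; rows containing horizontal
  sides are excluded, so all rows may be treated as open.\<close>

definition vis :: "real \<Rightarrow> nat \<Rightarrow> bool" where
  "vis y k \<longleftrightarrow> v \<le> y \<and> y < B t \<and> generic y \<and> k \<in> {1..i} \<and> B k < y \<and> y < T k \<and> R k < x \<and>
     (\<forall>j\<in>{1..i}. B j < y \<longrightarrow> y < T j \<longrightarrow> L j < x \<longrightarrow> R j \<le> R k)"

lemma genericD:
  assumes "generic y" "j \<in> {1..i}"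
  shows "B j \<le> y \<longleftrightarrow> B j < y" "y \<le> T j \<longleftrightarrow> y < T j"
proof -
  have "y \<noteq> B j" "y \<noteq> T j"
    using assms unfolding generic_def by blast+
  then show "B j \<le> y \<longleftrightarrow> B j < y" "y \<le> T j \<longleftrightarrow> y < T j"
    by linarith+
qed

lemma ex_generic:
  assumes "a < b"
  obtains y where "a < y" "y < b" "generic y"
proof -
  have "finite (B ` {1..i} \<union> T ` {1..i})" by simp
  from ex_between_avoiding[OF this assms] obtain y
    where y: "a < y" "y < b" "y \<notin> B ` {1..i} \<union> T ` {1..i}" .
  show ?thesis
    by (rule that[OF y(1,2)]) (use y(3) in \<open>simp only: generic_def not_False_eq_True\<close>)
qed

lemma not_crossing:
  assumes "j \<in> {1..i}" "v \<le> y" "y < B t" "B j \<le> y" "y \<le> T j" "L j \<le> x"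
  shows "R j < x"
proof (rule ccontr)
  assume "\<not> R j < x"
  then have "(x, y) \<in> E i"
    using assms by (auto simp: mem_E_iff)
  then show False using free assms by blast
qed

lemma vis_exists:
  assumes "v \<le> y" "y < B t" "generic y"
  obtains k where "vis y k"
proof -
  define J where "J = {j \<in> {1..i}. B j < y \<and> y < T j \<and> L j < x}"
  have "finite J" by (simp add: J_def)
  obtain j where j: "j \<in> {1..i}" "R j < x" "B j \<le> y" "y \<le> T j"
    using square_to_left assms by blast
  have "s j > 0" using sizes[OF in_n[OF j(1)]] by simp
  then have "j \<in> J"
    using j genericD[OF assms(3) j(1)] by (simp add: J_def)
  then have "Max ((\<lambda>m. R m) ` J) \<in> (\<lambda>m. R m) ` J"
    using \<open>finite J\<close> by (intro Max_in) auto
  then obtain k where k: "k \<in> J" "R k = Max ((\<lambda>m. R m) ` J)"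
    by (metis (no_types, lifting) imageE)
  have "\<forall>m\<in>J. R m \<le> R k"
    unfolding k(2) using \<open>finite J\<close> by simp
  moreover have "k \<in> {1..i}" "B k < y" "y < T k" "L k < x"
    using k(1) by (auto simp: J_def)
  moreover from this have "R k < x"
    using not_crossing[of k y] assms by simp
  ultimately have "vis y k"
    using assms unfolding vis_def J_def by blast
  with that show ?thesis by blast
qed

text \<open>Maximality in both directions gives equal right sides, and two squares spanning one row
  with equal right sides overlap.\<close>

lemma vis_unique:
  assumes "vis y j" "vis y k"
  shows "j = k"
proof (rule ccontr)
  assume "j \<noteq> k"
  have jk: "j \<in> {1..i}" "k \<in> {1..i}" "B j < y" "y < T j" "B k < y" "y < T k" "R j < x" "R k < x"
    using assms by (auto simp: vis_def)
  have pos: "s j > 0" "s k > 0"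
    using jk sizes in_n by auto
  have "L j < x" "L k < x"
    using jk pos by auto
  then have "R j = R k"
    using assms jk unfolding vis_def by (intro antisym) blast+
  then have "L j < R k" "L k < R j" "B j < T k" "B k < T j"
    using jk pos by auto
  then show False
    using disjoint[of j k] in_n[OF jk(1)] in_n[OF jk(2)] \<open>j \<noteq> k\<close> by blast
qed

text \<open>Anything to the right of \<open>k\<close> needs a descent to the floor, which would have to cross the
  row in which \<open>k\<close> is visible.\<close>

lemma vis_upwards:
  assumes vis: "vis y k" and y': "y \<le> y'" "y' < T k" "y' < B t" "generic y'"
  shows "vis y' k"
proof (rule ccontr)
  assume nv: "\<not> vis y' k"
  note k = vis[unfolded vis_def]
  have kn: "k \<in> {1..n}" "s k > 0" using k in_n sizes by auto
  obtain j where j: "j \<in> {1..i}" "B j < y'" "y' < T j" "L j < x" "R k < R j"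
    using nv k y' unfolding vis_def by (auto simp: not_le)
  have jn: "j \<in> {1..n}" "s j > 0" using j(1) in_n sizes by auto
  have "R j < x"
    using not_crossing[of j y'] j y' k by auto
  obtain \<phi> where \<phi>: "descent j y' \<phi>" "\<phi> y' = R j"
    using ex_descent[OF jn(1), of "R j" y'] j jn by auto
  have on: "\<exists>m\<in>{1..i}. m \<noteq> k \<and> L m \<le> \<phi> b \<and> \<phi> b \<le> R m \<and> B m \<le> b \<and> b \<le> T m"
    if "y \<le> b" "b \<le> y'" for b
  proof -
    have "b \<in> {0..y'}" using that k v_nonneg by auto
    then obtain m where m: "m \<in> {1..j}" "m = j \<or> T m \<le> B j"
      "L m \<le> \<phi> b" "\<phi> b \<le> R m" "B m \<le> b" "b \<le> T m"
      using \<phi>(1) unfolding descent_def by blast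
    moreover have "m \<noteq> k"
      using m(2) j y' by auto
    ultimately show ?thesis
      using j(1) by (intro bexI[of _ m]) auto
  qed
  \<comment> \<open>The midline of \<open>k\<close>. The descent starts to its right and, between
    rows \<open>y\<close> and \<open>y'\<close>, runs in other squares, so it can meet neither the
    midline nor the column. In row \<open>y\<close> it is still between them, in a square that
    visibility forces to overlap \<open>k\<close>.\<close>
  define c where "c = (L k + R k) / 2"
  have c: "L k < c" "c < R k" using kn by (auto simp: c_def)
  have cont: "continuous_on UNIV \<phi>"
    using \<phi>(1) by (simp add: descent_def)
  have avoid: "\<phi> b \<noteq> c \<and> \<phi> b \<noteq> x" if b: "y \<le> b" "b \<le> y'" for b
  proof -
    obtain m where m: "m \<in> {1..i}" "m \<noteq> k" "L m \<le> \<phi> b" "\<phi> b \<le> R m" "B m \<le> b" "b \<le> T m"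
      using on b by blast
    have "\<not> (L k < \<phi> b \<and> \<phi> b < R k \<and> B k < b \<and> b < T k)"
      using not_inside_other[OF in_n[OF m(1)] kn(1) m(2-6)] .
    moreover have "\<phi> b \<noteq> x"
      using not_crossing[of m b] m b k y' by auto
    ultimately show ?thesis
      using b c k y' by auto
  qed
  have "c < \<phi> y"
    by (rule stays_greater[OF cont y'(1)]) (use avoid c j \<phi>(2) in auto)
  moreover have "\<phi> y < x"
    by (rule stays_less[OF cont y'(1)]) (use avoid \<open>R j < x\<close> \<phi>(2) in auto)
  moreover obtain m where m: "m \<in> {1..i}" "m \<noteq> k" "L m \<le> \<phi> y" "\<phi> y \<le> R m" "B m \<le> y" "y \<le> T m"
    using on[of y] y' by auto
  ultimately have "L m < x" "c < R m" by auto
  have my: "B m < y" "y < T m"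
    using genericD[of y m] k m by auto
  have "R m \<le> R k"
    using k m(1) my \<open>L m < x\<close> by blast
  moreover have "s m > 0" using sizes in_n m(1) by auto
  ultimately have "L m < R k" "L k < R m" "B m < T k" "B k < T m"
    using my k c \<open>c < R m\<close> by auto
  then show False
    using disjoint[OF in_n[OF m(1)] kn(1) m(2)] by blast
qed

text \<open>If \<open>k\<close> rose above \<open>B t\<close>, it would lie to the left of
  \<open>t\<close>. By persistence it would still be visible just below \<open>B t\<close>, where
  the support from \<open>left_support\<close> reaches beyond \<open>L t\<close> and hides
  it.\<close>

lemma vis_top_le:
  assumes "vis y k"
  shows "T k \<le> B t"
proof (rule ccontr)
  assume "\<not> T k \<le> B t"
  note k = assms[unfolded vis_def]
  have kn: "k \<in> {1..n}" "s k > 0" and tn: "t \<in> {1..n}" "s t > 0"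
    using k t in_n sizes by auto
  have "k \<noteq> t" using k t by auto
  then have "R k \<le> L t"
    using disjoint[OF kn(1) tn(1)] k t \<open>\<not> T k \<le> B t\<close> kn tn by auto
  obtain c where c: "c \<in> {1..i}" "T c = B t" "L t < R c" "R c < x"
    using left_support by blast
  have "s c > 0" using sizes in_n c(1) by auto
  then have "max y (B c) < B t" using k c(2) by auto
  then obtain y' where y': "max y (B c) < y'" "y' < B t" "generic y'"
    using ex_generic by blast
  then have "vis y' k"
    using vis_upwards[OF assms, of y'] \<open>\<not> T k \<le> B t\<close> by auto
  then have "R c \<le> R k"
    using c y' \<open>s c > 0\<close> unfolding vis_def by auto
  then show False
    using c(3) \<open>R k \<le> L t\<close> by linarith
qed

text \<open>The decrease that drives the later induction. With the tops in the other order,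
  persistence would make both squares visible in the upper of the two rows.\<close>

lemma vis_top_less:
  assumes "vis y k" "vis y' k'" "y' < T k" "k' \<noteq> k"
  shows "T k' < T k"
proof (rule ccontr)
  assume *: "\<not> T k' < T k"
  have y: "generic y" "y < B t" "y < T k" "generic y'" "y' < B t" "y' < T k'"
    using assms by (auto simp: vis_def)
  have "vis y' k \<or> vis y k'"
  proof (cases "y \<le> y'")
    case True
    then show ?thesis using vis_upwards[OF assms(1)] assms(3) y by auto
  next
    case False
    then show ?thesis using vis_upwards[OF assms(2)] * y by auto
  qed
  then show False
    using vis_unique assms by blast
qed

text \<open>Otherwise \<open>k\<close> would fit at a lower height directly to the left of the column.\<close>

lemma ex_lower_blocker:
  assumes vis: "vis y k" and "v < B k"
  obtains y' k' where "vis y' k'" "k' \<noteq> k" "y' < T k" "B k \<le> T k'" "x < R k' + s k"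
proof -
  note k = vis[unfolded vis_def]
  have kn: "k \<in> {1..n}" "s k > 0" using k in_n sizes by auto
  have xW: "x < W" using t in_strip(2)[OF in_n[OF t(1)]] by auto
  have Lk: "0 \<le> L k" using in_strip kn by auto
  obtain b where b: "v \<le> b" "b < B k"
    and b_max: "\<forall>f\<in>T ` {1..i}. f < B k \<longrightarrow> f \<le> b"
    using ex_bound_below[OF _ assms(2), of "T ` {1..i}"] by blast
  \<comment> \<open>The position \<open>(x - s k, b)\<close> is flush with the column and slightly
    lower than \<open>k\<close>, hence blocked.\<close>
  have "0 \<le> x - s k" "x - s k + s k \<le> W" "0 \<le> b"
    using k Lk xW b v_nonneg by auto
  then obtain j where j: "j \<in> {1..<k}" "L j < x - s k + s k" "x - s k < R j" "B j < b + s k" "b < T j"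
    by (rule blocked_if_lex_smaller[OF kn(1), of "x - s k" b]) (simp add: b)
  have ji: "j \<in> {1..i}" and jn: "j \<in> {1..n}" "s j > 0" "j \<noteq> k"
    using j(1) k in_n sizes by auto
  \<comment> \<open>There is a row common to the blocker \<open>j\<close> and the lowered copy of
    \<open>k\<close>. The square visible there reaches at least as far right as \<open>j\<close>; it
    is not \<open>k\<close>, since then \<open>j\<close> would overlap \<open>k\<close>.\<close>
  have "max b (B j) < min (T j) (b + s k)"
    using j jn kn by auto
  then obtain y' where y': "max b (B j) < y'" "y' < min (T j) (b + s k)" "generic y'"
    using ex_generic by blast
  have "y' < T k" "y' < B t" "v \<le> y'"
    using y' b vis_top_le[OF vis] by auto
  then obtain k' where k': "vis y' k'"
    using vis_exists y'(3) by blast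
  then have Rj: "R j \<le> R k'"
    using ji j y' unfolding vis_def by auto
  have "k' \<noteq> k"
  proof
    assume "k' = k"
    then have "L j < R k" "L k < R j" "B j < T k" "B k < T j"
      using k' Rj j y' k jn unfolding vis_def by auto
    then show False using disjoint[OF jn(1) kn(1) jn(3)] by blast
  qed
  moreover have "k' \<in> {1..i}" "b < T k'"
    using k' y' by (auto simp: vis_def)
  then have "B k \<le> T k'"
    using bspec[OF b_max imageI[of k']] by linarith
  ultimately show ?thesis
    using that[OF k'] \<open>y' < T k\<close> Rj j by auto
qed

text \<open>The first alternative is the translate by \<open>(s k, 0)\<close>; in the second, the
  three translates moved down by \<open>s k\<close> together span the range from \<open>L k\<close>
  to \<open>R k + 2 * s k\<close>.\<close>

lemma covered:
  obtains k where "k = t \<or> (\<exists>y. vis y k)" "k \<in> {1..i}"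
    "B k \<le> v \<and> v \<le> T k \<and> R k \<le> x \<and> x \<le> R k + s k \<or>
     B k - s k \<le> v \<and> v \<le> B k \<and> L k \<le> x \<and> x \<le> R k + 2 * s k"
proof (rule ccontr)
  assume "\<not> thesis"
  with that have uncovered: "\<not> (B k \<le> v \<and> v \<le> T k \<and> R k \<le> x \<and> x \<le> R k + s k)"
    "\<not> (B k - s k \<le> v \<and> v \<le> B k \<and> L k \<le> x \<and> x \<le> R k + 2 * s k)"
    if "k = t \<or> (\<exists>y. vis y k)" "k \<in> {1..i}" for k
    using that by blast+
  have claim: "T k - v < x - R k" if "vis y k" for y k
    using that
  \<comment> \<open>Tops are reals, so the induction runs on the number of squares with lower
    top.\<close>
  proof (induction "card {j \<in> {1..i}. T j < T k}" arbitrary: y k rule: less_induct)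
    case less
    note k = less.prems[unfolded vis_def]
    have kn: "s k > 0" using k in_n sizes by auto
    show ?case
    proof (cases "B k \<le> v")
      case True
      moreover have "\<not> (B k \<le> v \<and> v \<le> T k \<and> R k \<le> x \<and> x \<le> R k + s k)"
        using uncovered(1)[of k] less.prems k by blast
      ultimately show ?thesis
        using k by auto
    next
      case False
      then obtain y' k' where k': "vis y' k'" "k' \<noteq> k" "y' < T k" "B k \<le> T k'" "x < R k' + s k"
        using ex_lower_blocker[OF less.prems] by auto
      have "T k' < T k"
        using vis_top_less[OF less.prems k'(1,3,2)] .
      moreover have "k' \<in> {1..i}" using k'(1) by (simp add: vis_def)
      ultimately have "{j \<in> {1..i}. T j < T k'} \<subset> {j \<in> {1..i}. T j < T k}"
        by auto
      then have "card {j \<in> {1..i}. T j < T k'} < card {j \<in> {1..i}. T j < T k}"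
        by (intro psubset_card_mono) auto
      then have "T k' - v < x - R k'"
        using less.hyps k'(1) by blast
      moreover have "\<not> (B k - s k \<le> v \<and> v \<le> B k \<and> L k \<le> x \<and> x \<le> R k + 2 * s k)"
        using uncovered(2)[of k] less.prems k by blast
      \<comment> \<open>As \<open>B k - v \<le> T k' - v < x - R k' < s k\<close>, the second
        alternative can only fail by \<open>x - R k > 2 * s k\<close>, which exceeds
        \<open>s k + (B k - v)\<close>.\<close>
      ultimately show ?thesis
        using k k' False kn by auto
    qed
  qed
  obtain c where c: "c \<in> {1..i}" "T c = B t" "L t < R c" "R c < x"
    using left_support by blast
  have "s c > 0" using sizes in_n c(1) by auto
  have *: "max v (B c) < B t"
    using t(4) c(2) \<open>s c > 0\<close> by auto
  \<comment> \<open>Just below \<open>B t\<close>, the visible square reaches at least as far right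
    as the support \<open>c\<close>, and its top is at least \<open>B t\<close>. The claim then
    yields \<open>B t - v < x - L t < s t\<close>, so \<open>t\<close> moved down by its side
    contains \<open>(x, v)\<close>.\<close>
  obtain b where b: "max v (B c) \<le> b" "b < B t"
    and b_max: "\<forall>f\<in>T ` {1..i}. f < B t \<longrightarrow> f \<le> b"
    using ex_bound_below[OF _ *, of "T ` {1..i}"] by blast
  obtain y where y: "b < y" "y < B t" "generic y"
    using ex_generic[OF b(2)] by blast
  then obtain k where k: "vis y k"
    using vis_exists[of y] b by auto
  have "R c \<le> R k"
    using k c b y unfolding vis_def by auto
  moreover have "k \<in> {1..i}" "b < T k"
    using k y by (auto simp: vis_def)
  then have "B t \<le> T k"
    using bspec[OF b_max imageI[of k]] by linarith
  ultimately have "B t - v < s t"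
    using claim[OF k] c(3) t(3) by linarith
  then show False
    using uncovered(2)[of t] t sizes[OF in_n[OF t(1)]] by auto
qed

end

section \<open>Pieces: maximality and unboundedness at earlier stages\<close>

locale right_i_piece = bl_packing +
  fixes i :: nat and U :: "point set"
  assumes i: "i \<in> {1..n}"
    and piece: "U \<in> pieces W s p i"
    and right: "right_piece W U"
begin

lemma pieces_before_iff: "P \<in> pieces_before W s p k \<longleftrightarrow> (\<exists>j<k. P \<in> pieces W s p j)"
  by (induction k) (auto simp: pieces_def less_Suc_eq)

lemma mem_pieces_iff:
  "P \<in> pieces W s p k \<longleftrightarrow>
     P \<in> components (strip W - (E k \<union> \<Union>(pieces_before W s p k))) \<and> bounded P"
  by (simp add: pieces_def new_pieces_def E_def)

text \<open>Take the least index of a piece met by \<open>C\<close>. No earlier piece meets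
  \<open>C\<close>, so \<open>C\<close> lies in the set whose components are formed at that stage,
  hence in the piece it meets.\<close>

lemma connected_subset_piece:
  assumes C: "connected C" "C \<subseteq> strip W - E k"
    and "j \<le> k" "P \<in> pieces W s p j" "C \<inter> P \<noteq> {}"
  shows "\<exists>j'\<le>j. \<exists>P'\<in>pieces W s p j'. C \<subseteq> P'"
  using assms(3-)
proof (induction j arbitrary: P rule: less_induct)
  case (less j)
  show ?case
  proof (cases "\<exists>j'<j. \<exists>P'\<in>pieces W s p j'. C \<inter> P' \<noteq> {}")
    case True
    then obtain j' P' where "j' < j" "P' \<in> pieces W s p j'" "C \<inter> P' \<noteq> {}" by blast
    then show ?thesis
      using less.IH[of j' P'] less.prems(1) by (meson less_imp_le order_trans)
  next
    case False
    then have "C \<inter> \<Union>(pieces_before W s p j) = {}"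
      using pieces_before_iff[of _ j] by blast
    then have "C \<subseteq> strip W - (E j \<union> \<Union>(pieces_before W s p j))"
      using C(2) E_mono[OF less.prems(1)] by blast
    moreover have "P \<in> components (strip W - (E j \<union> \<Union>(pieces_before W s p j)))"
      using less.prems(2) by (simp add: mem_pieces_iff)
    ultimately have "C \<subseteq> P"
      using components_maximal[OF _ C(1)] less.prems(3) by (metis inf_commute)
    then show ?thesis
      using less.prems(2) by blast
  qed
qed

lemma U_avoids:
  shows "U \<subseteq> strip W - E i" and "\<lbrakk>P \<in> pieces W s p j; j < i\<rbrakk> \<Longrightarrow> U \<inter> P = {}"
proof -
  have "U \<subseteq> strip W - (E i \<union> \<Union>(pieces_before W s p i))"
    using piece in_components_subset by (auto simp: mem_pieces_iff)
  then show "U \<subseteq> strip W - E i" "\<lbrakk>P \<in> pieces W s p j; j < i\<rbrakk> \<Longrightarrow> U \<inter> P = {}"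
    using pieces_before_iff[of P i] by blast+
qed

lemma U_connected: "connected U" and U_bounded: "bounded U"
  using piece in_components_connected by (auto simp: mem_pieces_iff)

text \<open>Removing earlier pieces does not cut \<open>U\<close> off: a connected set meeting one
  of them is contained in an earlier piece, and \<open>U\<close> avoids those.\<close>

lemma U_maximal:
  assumes "connected C" "C \<subseteq> strip W - E i" "C \<inter> U \<noteq> {}"
  shows "C \<subseteq> U"
proof -
  have "C \<inter> P = {}" if j: "j < i" and P: "P \<in> pieces W s p j" for j P
  proof (rule ccontr)
    assume "C \<inter> P \<noteq> {}"
    then obtain j' P' where "j' \<le> j" "P' \<in> pieces W s p j'" "C \<subseteq> P'"
      using connected_subset_piece[OF assms(1,2) less_imp_le[OF j] P] by blast
    then show False
      using U_avoids(2)[of P' j'] assms(3) j by auto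
  qed
  then have "C \<subseteq> strip W - (E i \<union> \<Union>(pieces_before W s p i))"
    using assms(2) pieces_before_iff[of _ i] by blast
  moreover have "U \<in> components (strip W - (E i \<union> \<Union>(pieces_before W s p i)))"
    using piece by (simp add: mem_pieces_iff)
  ultimately show ?thesis
    using components_maximal[OF _ assms(1)] assms(3) by (metis inf_commute)
qed

text \<open>A bounded component would be contained in a piece of index at most \<open>k\<close>, and
  \<open>U\<close> avoids all of these because \<open>k < i\<close>.\<close>

lemma component_unbounded:
  assumes "u \<in> U" "k < i"
  shows "\<not> bounded (connected_component_set (strip W - E k) u)" (is "\<not> bounded ?C")
proof
  assume "bounded ?C"
  have "u \<in> strip W - E k"
    using assms U_avoids(1) E_mono[of k i] by auto
  then have uC: "u \<in> ?C" by simp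
  have C: "connected ?C" "?C \<subseteq> strip W - E k"
    by (simp_all add: connected_component_subset)
  have avoid: "?C \<inter> P = {}" if j: "j \<le> k" and P: "P \<in> pieces W s p j" for j P
  proof (rule ccontr)
    assume "?C \<inter> P \<noteq> {}"
    then obtain j' P' where "j' \<le> j" "P' \<in> pieces W s p j'" "?C \<subseteq> P'"
      using connected_subset_piece[OF C j P] by blast
    moreover from this have "u \<in> P'" using uC by blast
    ultimately show False
      using U_avoids(2)[of P' j'] assms j by auto
  qed
  let ?V = "strip W - (E k \<union> \<Union>(pieces_before W s p k))"
  have "?C \<subseteq> ?V"
    using avoid C(2) pieces_before_iff[of _ k] less_imp_le by blast
  then have "?C \<subseteq> connected_component_set ?V u"
    using connected_component_maximal[OF uC C(1)] by blast
  moreover have "connected_component_set ?V u \<subseteq> ?C"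
    by (rule connected_component_mono) auto
  ultimately have "connected_component_set ?V u = ?C" by (rule equalityI[rotated])
  moreover have "u \<in> ?V" using \<open>?C \<subseteq> ?V\<close> uC by (rule subsetD)
  ultimately have "?C \<in> components ?V"
    using componentsI[of u ?V] by simp
  then have "?C \<in> pieces W s p k"
    using \<open>bounded ?C\<close> by (simp add: mem_pieces_iff)
  then show False
    using avoid[of k ?C] uC by blast
qed

text \<open>The common shape of the contradictions below: two paths and a lid at a stage before
  \<open>i\<close> would make a component bounded.\<close>

lemma not_enclosed:
  assumes "(x, v) \<in> U" "k < i" "v < y" "\<phi> v < x" "x < \<psi> v"
    and cont: "continuous_on UNIV \<phi>" "continuous_on UNIV \<psi>"
    and lside: "\<And>b. 0 \<le> b \<Longrightarrow> b \<le> y \<Longrightarrow> (\<phi> b, b) \<notin> strip W - E k"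
    and rside: "\<And>b. 0 \<le> b \<Longrightarrow> b \<le> y \<Longrightarrow> (\<psi> b, b) \<notin> strip W - E k"
    and lid: "\<And>a. \<phi> y < a \<Longrightarrow> a < \<psi> y \<Longrightarrow> (a, y) \<notin> strip W - E k"
  shows False
proof -
  let ?C = "connected_component_set (strip W - E k) (x, v)"
  have C: "connected ?C" "?C \<subseteq> strip W - E k"
    by (simp_all add: connected_component_subset)
  have "(x, v) \<in> strip W - E k"
    using assms(1,2) U_avoids(1) E_mono[of k i] by auto
  then have "(x, v) \<in> ?C" by simp
  have "w \<in> {0..W} \<times> {0..y}" if w: "w \<in> ?C" for w
  proof -
    have "snd w < y"
      using enclosed[OF cont lside rside lid C \<open>(x, v) \<in> ?C\<close> _ _ _ w] assms(3-5) by simp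
    moreover have "w \<in> strip W"
      using C(2) w by blast
    ultimately show ?thesis
      by (simp add: strip_def mem_Times_iff)
  qed
  then have "?C \<subseteq> {0..W} \<times> {0..y}" by blast
  then have "bounded ?C"
    using bounded_subset bounded_Times bounded_closed_interval by metis
  then show False
    using component_unbounded[OF assms(1,2)] by blast
qed

text \<open>\<open>E i\<close> is closed, and a ball meets the strip in a convex, hence connected,
  set; maximality of \<open>U\<close> does the rest.\<close>

lemma in_U_near:
  assumes "u \<in> U"
  obtains e where "e > 0" "\<And>z. z \<in> strip W \<Longrightarrow> dist u z < e \<Longrightarrow> z \<in> U"
proof -
  have "u \<in> - E i" using assms U_avoids(1) by auto
  then obtain e where e: "e > 0" "ball u e \<subseteq> - E i"
    using closed_E[of i] open_contains_ball by (metis open_Compl)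
  have "convex (ball u e \<inter> strip W)"
    unfolding strip_def by (intro convex_Int convex_Times convex_ball) auto
  then have "connected (ball u e \<inter> strip W)"
    by (rule convex_connected)
  moreover have "ball u e \<inter> strip W \<subseteq> strip W - E i"
    using e(2) by blast
  moreover have "u \<in> ball u e \<inter> strip W \<inter> U"
    using assms U_avoids(1) e(1) by auto
  ultimately have "ball u e \<inter> strip W \<subseteq> U"
    using U_maximal by blast
  then show ?thesis
    using that[OF e(1)] by (auto simp: subset_iff)
qed

lemma ex_in_U_avoiding:
  assumes "u \<in> U" "finite F" "e > 0"
  obtains a where "a \<notin> F" "\<bar>a - fst u\<bar> < e" "(a, snd u) \<in> U"
proof -
  obtain d where d: "d > 0" "\<And>z. z \<in> strip W \<Longrightarrow> dist u z < d \<Longrightarrow> z \<in> U"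
    using in_U_near[OF assms(1)] by blast
  have u: "0 \<le> fst u" "fst u \<le> W" "0 \<le> snd u"
    using assms(1) U_avoids(1) by (auto simp: strip_def)
  define m where "m = min d e"
  have m: "m > 0" using d assms by (simp add: m_def)
  have "max 0 (fst u - m) < min W (fst u + m)"
    using u m W_pos by auto
  then obtain a where a: "max 0 (fst u - m) < a" "a < min W (fst u + m)" "a \<notin> F"
    using ex_between_avoiding[OF assms(2)] by metis
  have "dist u (a, snd u) = \<bar>a - fst u\<bar>"
    by (cases u) (simp add: dist_prod_def dist_real_def)
  moreover have "\<bar>a - fst u\<bar> < m" using a by auto
  ultimately show ?thesis
    using that[of a] a u d(2)[of "(a, snd u)"] by (auto simp: m_def strip_def)
qed

section \<open>Columns inside the piece and the right wall\<close>

text \<open>If nothing lay above \<open>(x, v)\<close>, a vertical ray would belong to the bounded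
  set \<open>U\<close>. So \<open>t\<close> can be chosen with the lowest bottom among the squares
  above.\<close>

lemma ex_above:
  assumes "(x, v) \<in> U"
  obtains t where "t \<in> {1..i}" "L t \<le> x" "x \<le> R t" "v < B t"
    "\<And>y. v \<le> y \<Longrightarrow> y < B t \<Longrightarrow> (x, y) \<in> U"
proof -
  have xv: "0 \<le> x" "x \<le> W" "0 \<le> v" "(x, v) \<notin> E i"
    using assms U_avoids(1) by (auto simp: strip_def)
  define J where "J = {j \<in> {1..i}. L j \<le> x \<and> x \<le> R j \<and> v < B j}"
  have in_U: "{x} \<times> Y \<subseteq> U"
    if Y: "v \<in> Y" "Y \<subseteq> {v..}" "connected Y" "\<And>y j. y \<in> Y \<Longrightarrow> j \<in> J \<Longrightarrow> y < B j" for Y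
  proof (rule U_maximal)
    show "connected ({x} \<times> Y)" using Y(3) by (intro connected_Times) auto
    show "{x} \<times> Y \<inter> U \<noteq> {}" using Y(1) assms by auto
    have "(x, y) \<notin> E i" if y: "y \<in> Y" for y
    proof
      assume "(x, y) \<in> E i"
      then obtain j where j: "j \<in> {1..i}" "L j \<le> x" "x \<le> R j" "B j \<le> y" "y \<le> T j"
        by (auto simp: mem_E_iff)
      have "\<not> v < B j" using Y(4)[OF y, of j] j by (auto simp: J_def)
      then have "(x, v) \<in> E i"
        using j Y(2) y by (force simp: mem_E_iff)
      then show False using xv by blast
    qed
    then show "{x} \<times> Y \<subseteq> strip W - E i"
      using Y(2) xv by (auto simp: strip_def)
  qed
  have "J \<noteq> {}"
  proof
    assume "J = {}"
    then have "{x} \<times> {v..} \<subseteq> U" by (intro in_U) auto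
    then have "bounded ({x} \<times> {v..})" using U_bounded bounded_subset by blast
    then have "bounded (snd ` ({x} \<times> {v..}))" by (rule bounded_snd)
    then obtain a where "\<forall>y\<in>{v..}. \<bar>y\<bar> \<le> a"
      by (auto simp: bounded_iff)
    then show False by (metis abs_ge_self atLeast_iff gt_ex linorder_not_le max.cobounded1 max.coboundedI2 order_less_le_trans)
  qed
  moreover have "finite J" by (simp add: J_def)
  ultimately have "Min ((\<lambda>j. B j) ` J) \<in> (\<lambda>j. B j) ` J"
    by (intro Min_in) auto
  then obtain t where t: "t \<in> J" "B t = Min ((\<lambda>j. B j) ` J)"
    by (metis (no_types, lifting) imageE)
  have "B t \<le> B j" if "j \<in> J" for j
    unfolding t(2) using \<open>finite J\<close> that by simp
  then have "{x} \<times> {v..<B t} \<subseteq> U"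
    using t(1) by (intro in_U) (force simp: J_def)+
  then have "(x, y) \<in> U" if "v \<le> y" "y < B t" for y
    using that by auto
  then show ?thesis
    using that[of t] t(1) unfolding J_def by blast
qed

text \<open>Otherwise the point of the column at height \<open>max v (B c)\<close> would lie in
  square \<open>c\<close>.\<close>

lemma column_avoids:
  assumes "\<And>y. v \<le> y \<Longrightarrow> y < B t \<Longrightarrow> (x, y) \<in> U" "v < B t"
    and "c \<in> {1..i}" "T c = B t" "L c \<le> x"
  shows "R c < x"
proof (rule ccontr)
  assume "\<not> R c < x"
  have "s c > 0" using sizes assms(3) i by auto
  then have "(x, max v (B c)) \<in> U"
    using assms by auto
  moreover have "(x, max v (B c)) \<in> E i"
    using assms \<open>\<not> R c < x\<close> \<open>s c > 0\<close> by (auto simp: mem_E_iff intro!: bexI[of _ c])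
  ultimately show False using U_avoids(1) by blast
qed

text \<open>Below a square touching the right wall, everything to the right of its supports is cut off,
  so this square must be the last one.\<close>

lemma last_at_wall:
  shows "R i = W" "B i > 0"
    and "\<lbrakk>c \<in> {1..<i}; T c = B i; L c < R i; L i < R c\<rbrakk> \<Longrightarrow>
      \<exists>\<phi>. descent i (T i) \<phi> \<and> L c \<le> \<phi> (B i) \<and> (\<forall>(x, v)\<in>U. v < T i \<and> \<phi> v < x)"
proof -
  obtain h where h: "(W, h) \<in> closure U"
    using right by (auto simp: right_piece_def)
  have "finite ((\<lambda>j. - s j) ` {1..i} \<union> (\<lambda>j. R j - W) ` {1..i})" by simp
  \<comment> \<open>The negative \<open>e\<close> is so close to 0 that every side is at least
    \<open>- e\<close> and every right side off the wall is at most \<open>W + e\<close>. Only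
    squares at the wall reach beyond \<open>W + e\<close>, and none starts there.\<close>
  from ex_bound_below[OF this, of "-1" 0] obtain e where
    e: "e < 0" "\<forall>f\<in>(\<lambda>j. - s j) ` {1..i} \<union> (\<lambda>j. R j - W) ` {1..i}. f < 0 \<longrightarrow> f \<le> e"
    by auto
  have e_s: "- s j \<le> e" and e_R: "R j \<le> W + e \<or> R j = W" if "j \<in> {1..i}" for j
  proof -
    have "j \<in> {1..n}" using that i by auto
    then have "- s j < 0" "R j \<le> W" using sizes in_strip by auto
    moreover have "- s j < 0 \<longrightarrow> - s j \<le> e" "R j - W < 0 \<longrightarrow> R j - W \<le> e"
      using e(2) that by blast+
    ultimately show "- s j \<le> e" "R j \<le> W + e \<or> R j = W" by linarith+
  qed
  obtain u where u: "u \<in> U" "dist u (W, h) < - e / 2"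
    using h e(1) closure_approachable[of "(W, h)" U] by (metis divide_pos_pos neg_0_less_iff_less zero_less_numeral)
  have "\<bar>fst u - W\<bar> < - e / 2"
    using u(2) dist_fst_le[of u "(W, h)"] by (simp add: dist_real_def)
  obtain a where a: "\<bar>a - fst u\<bar> < - e / 2" "(a, snd u) \<in> U"
    using ex_in_U_avoiding[OF u(1), of "{}" "- e / 2"] e(1) by auto
  define b where "b = snd u"
  have "a > W + e" "(a, b) \<in> U"
    using a \<open>\<bar>fst u - W\<bar> < - e / 2\<close> by (auto simp: b_def abs_if split: if_splits)
  then have "a \<le> W" "0 \<le> b" using U_avoids(1) by (auto simp: strip_def)
  obtain t where t: "t \<in> {1..i}" "L t \<le> a" "a \<le> R t" "b < B t"
    and col: "\<And>y. b \<le> y \<Longrightarrow> y < B t \<Longrightarrow> (a, y) \<in> U"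
    using ex_above[OF \<open>(a, b) \<in> U\<close>] by blast
  have tn: "t \<in> {1..n}" "s t > 0" using t i sizes by auto
  have Rt: "R t = W" using e_R[OF t(1)] t(3) \<open>a > W + e\<close> by auto
  have Bt: "B t > 0" using \<open>0 \<le> b\<close> t(4) by simp
  \<comment> \<open>A path from the top left corner of \<open>t\<close> through its support
    \<open>c\<close>, which lies left of the column. Below \<open>B t\<close> the column is in
    \<open>U\<close> and the path in squares, so the path stays on the left.\<close>
  have key: "\<exists>\<phi>. descent t (T t) \<phi> \<and> \<phi> (T t) = L t \<and> L c \<le> \<phi> (B t) \<and> \<phi> b < a"
    if c: "c \<in> {1..<t}" "T c = B t" "L c < R t" "L t < R c" for c
  proof -
    have ci: "c \<in> {1..i}" using c t by auto
    have "R c < a"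
    proof (cases "L c \<le> a")
      case True
      then show ?thesis using column_avoids[OF col t(4) ci c(2)] by blast
    next
      case False
      then show ?thesis
        using e_R[OF ci] e_s[OF ci] \<open>a > W + e\<close> by auto
    qed
    obtain \<phi> a' where \<phi>: "descent t (T t) \<phi>" "\<phi> (T t) = L t" "\<phi> (B t) = a'" "L c \<le> a'" "a' \<le> R c"
      by (rule ex_descent_via[OF tn(1), of "L t" "T t" c]) (use c tn in auto)
    have "\<phi> b < a"
    proof (rule stays_less[of \<phi> b "B t"])
      show "continuous_on UNIV \<phi>" using \<phi>(1) by (simp add: descent_def)
      show "b \<le> B t" "\<phi> (B t) < a" using t \<phi> \<open>R c < a\<close> by auto
      fix y assume y: "b \<le> y" "y \<le> B t"
      show "\<phi> y \<noteq> a"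
      proof (cases "y = B t")
        case False
        then have "(a, y) \<notin> E i" using col[of y] y U_avoids(1) by auto
        moreover have "(\<phi> y, y) \<in> E i"
          using descent_in_E[OF \<phi>(1), of y] E_mono[of t i] y \<open>0 \<le> b\<close> t tn by auto
        ultimately show ?thesis by auto
      qed (use \<phi> \<open>R c < a\<close> in auto)
    qed
    then show ?thesis using \<phi> by blast
  qed
  have cont: "continuous_on UNIV \<phi>" if "descent t (T t) \<phi>" for \<phi>
    using that by (simp add: descent_def)
  have side: "(\<phi> y, y) \<notin> strip W - E t" if "descent t (T t) \<phi>" "0 \<le> y" "y \<le> T t" for \<phi> y
    using descent_in_E[OF that] by blast
  \<comment> \<open>The line at \<open>W + 1\<close> plays the right wall, so that points with first
    coordinate \<open>W\<close> are strictly inside.\<close>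
  have wall: "(W + 1, y) \<notin> strip W - E t" for y
    by (auto simp: strip_def)
  have lid: "(a, T t) \<notin> strip W - E t" if "L t < a" for a
    using that Rt tn t by (auto simp: strip_def mem_E_iff intro!: bexI[of _ t])
  have "t = i"
  proof (rule ccontr)
    assume "t \<noteq> i"
    then have "t < i" using t by auto
    obtain c where "c \<in> {1..<t}" "T c = B t" "L c < R t" "L t < R c"
      using ex_support[OF tn(1) Bt] by blast
    then obtain \<phi> where \<phi>: "descent t (T t) \<phi>" "\<phi> (T t) = L t" "\<phi> b < a"
      using key by blast
    show False
      by (rule not_enclosed[OF \<open>(a, b) \<in> U\<close> \<open>t < i\<close>, of "T t" \<phi> "\<lambda>_. W + 1"])
        (use \<phi> t tn \<open>a \<le> W\<close> cont side wall lid in auto)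
  qed
  show "R i = W" "B i > 0" using Rt Bt \<open>t = i\<close> by auto
  show "\<lbrakk>c \<in> {1..<i}; T c = B i; L c < R i; L i < R c\<rbrakk> \<Longrightarrow>
      \<exists>\<phi>. descent i (T i) \<phi> \<and> L c \<le> \<phi> (B i) \<and> (\<forall>(x, v)\<in>U. v < T i \<and> \<phi> v < x)"
  proof -
    assume c: "c \<in> {1..<i}" "T c = B i" "L c < R i" "L i < R c"
    obtain \<phi> where \<phi>: "descent t (T t) \<phi>" "\<phi> (T t) = L t" "L c \<le> \<phi> (B t)" "\<phi> b < a"
      using key[of c] c \<open>t = i\<close> by blast
    \<comment> \<open>Now \<open>t\<close> is the last square, and the same walls enclose the
      connected set \<open>U\<close> itself.\<close>
    have "snd w < T t \<and> \<phi> (snd w) < fst w \<and> fst w < W + 1" if "w \<in> U" for w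
      by (rule enclosed[where C = U and k = t and z = "(a, b)" and \<psi> = "\<lambda>_. W + 1"])
        (use \<phi> t tn \<open>a \<le> W\<close> \<open>(a, b) \<in> U\<close> cont side wall lid U_connected U_avoids(1) \<open>t = i\<close> that in auto)
    then show ?thesis
      using \<phi> \<open>t = i\<close> by (intro exI[of _ \<phi>]) force
  qed
qed

text \<open>The descent on the left of \<open>U\<close> passes through some square in row
  \<open>y\<close>; as \<open>(x, y)\<close> lies in no square, this one ends before
  \<open>x\<close>.\<close>

lemma ex_left_square:
  assumes "(x, y) \<in> U"
  shows "\<exists>j\<in>{1..i}. R j < x \<and> B j \<le> y \<and> y \<le> T j"
proof -
  obtain c where "c \<in> {1..<i}" "T c = B i" "L c < R i" "L i < R c"
    using ex_support[OF i last_at_wall(2)] by blast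
  then obtain \<phi> where \<phi>: "descent i (T i) \<phi>" "\<forall>(x, v)\<in>U. v < T i \<and> \<phi> v < x"
    using last_at_wall(3) by blast
  have xy: "y < T i" "\<phi> y < x" "0 \<le> y" "(x, y) \<notin> E i"
    using assms \<phi>(2) U_avoids(1) by (auto simp: strip_def)
  then have "(\<phi> y, y) \<in> E i"
    using descent_in_E[OF \<phi>(1)] by simp
  then show ?thesis
    using xy by (force simp: mem_E_iff)
qed

text \<open>A support on the right of the column, the square itself and its left contact would cut off
  the column.\<close>

lemma supports_left_of_column:
  assumes "(x, v) \<in> U" "t \<in> {1..i}" "L t < x" "x < R t" "v < B t"
    and col: "\<And>y. v \<le> y \<Longrightarrow> y < B t \<Longrightarrow> (x, y) \<in> U"
    and c: "c \<in> {1..<t}" "T c = B t" "L c < R t" "L t < R c"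
  shows "R c < x"
proof (cases "L c \<le> x")
  case True
  then show ?thesis
    using column_avoids[OF col assms(5) _ c(2)] c(1) assms(2) by auto
next
  case False
  have tn: "t \<in> {1..n}" "s t > 0" using assms(2) i sizes by auto
  have v: "0 \<le> v" using assms(1) U_avoids(1) by (auto simp: strip_def)
  have not_x: "\<phi> y \<noteq> x" if "descent m b \<phi>" "m \<le> i" "v \<le> y" "y < B t" "y \<le> b" for \<phi> m b y
  proof -
    have "(x, y) \<notin> E i" using col[of y] that U_avoids(1) by auto
    moreover have "(\<phi> y, y) \<in> E i"
      using descent_in_E[OF that(1), of y] E_mono[of m i] that v by auto
    ultimately show ?thesis by auto
  qed
  \<comment> \<open>At height \<open>B t\<close> a descent through \<open>c\<close> is right of the
    column, which it cannot cross further down.\<close>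
  have right_of_x: "x < \<phi> v" if \<phi>: "descent t b \<phi>" "B t \<le> b" "L c \<le> \<phi> (B t)" for \<phi> b
  proof (rule stays_greater[of \<phi> v "B t"])
    show "continuous_on UNIV \<phi>" using \<phi>(1) by (simp add: descent_def)
    show "v \<le> B t" "x < \<phi> (B t)" using assms(5) \<phi>(3) False by auto
    show "\<phi> y \<noteq> x" if "v \<le> y" "y \<le> B t" for y
      using not_x[OF \<phi>(1), of y] that assms(2) \<phi> False by (cases "y = B t") auto
  qed
  have False
  proof (cases "t = i")
    case True
    \<comment> \<open>For the last square, the descent through \<open>c\<close> would pass both left
      of \<open>U\<close> and right of the column.\<close>
    then obtain \<phi> where \<phi>: "descent i (T i) \<phi>" "L c \<le> \<phi> (B i)" "\<forall>(x, v)\<in>U. v < T i \<and> \<phi> v < x"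
      using last_at_wall(3) c by blast
    then have "x < \<phi> v" using right_of_x[of "T i" \<phi>] True tn by auto
    moreover have "\<phi> v < x" using \<phi>(3) assms(1) by blast
    ultimately show False by simp
  next
    case False
    then have "t < i" using assms(2) by auto
    \<comment> \<open>The right side of the enclosure is the descent from \<open>(L t, Y)\<close>
      through \<open>c\<close>. What remains is a left side \<open>\<phi>\<close> and a lid joining
      its upper end to \<open>(L t, Y)\<close>.\<close>
    have *: False if Y: "B t < Y" "Y \<le> T t"
      and \<phi>: "continuous_on UNIV \<phi>" "\<phi> Y \<le> L t" "\<phi> v < x"
        "\<And>y. 0 \<le> y \<Longrightarrow> y \<le> Y \<Longrightarrow> (\<phi> y, y) \<notin> strip W - E t"
        "\<And>a. \<phi> Y < a \<Longrightarrow> a < L t \<Longrightarrow> (a, Y) \<notin> strip W - E t" for Y \<phi>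
    proof -
      obtain \<psi> a' where \<psi>: "descent t Y \<psi>" "\<psi> Y = L t" "\<psi> (B t) = a'" "L c \<le> a'"
        by (rule ex_descent_via[OF tn(1), of "L t" Y c]) (use c tn Y in auto)
      have "x < \<psi> v" using right_of_x[OF \<psi>(1)] \<psi> Y by auto
      show False
      proof (rule not_enclosed[OF assms(1) \<open>t < i\<close>, where y = Y and \<phi> = \<phi> and \<psi> = \<psi>])
        show "continuous_on UNIV \<psi>" using \<psi>(1) by (simp add: descent_def)
        show "v < Y" using assms(5) Y by simp
        show "(\<psi> b, b) \<notin> strip W - E t" if "0 \<le> b" "b \<le> Y" for b
          using descent_in_E[OF \<psi>(1) that] by blast
        show "(a, Y) \<notin> strip W - E t" if "\<phi> Y < a" "a < \<psi> Y" for a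
          using \<phi>(5) that \<psi>(2) by simp
      qed fact+
    qed
    show False
    proof (cases "L t = 0")
      case True
      show False
        by (rule *[of "T t" "\<lambda>_. -1"]) (use True tn assms(3) in \<open>auto simp: strip_def\<close>)
    next
      case False
      then have "L t > 0" using in_strip[OF tn(1)] by auto
      then obtain m where m: "m \<in> {1..<t}" "R m = L t" "B m < T t" "B t < T m"
        using ex_left_contact[OF tn(1)] by blast
      have mn: "m \<in> {1..n}" "s m > 0" using m tn sizes by auto
      \<comment> \<open>At this height \<open>t\<close> and its left contact \<open>m\<close> touch,
        so both sides of the enclosure start at \<open>(L t, Y)\<close> and the lid is
        empty.\<close>
      define Y where "Y = min (T t) (T m)"
      have Y: "B t < Y" "Y \<le> T t" "B m < Y" "Y \<le> T m"
        using m tn mn by (auto simp: Y_def)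
      obtain \<phi> where \<phi>: "descent m Y \<phi>" "\<phi> Y = R m"
        using ex_descent[OF mn(1), of "R m" Y] Y mn by auto
      have cont: "continuous_on UNIV \<phi>" using \<phi>(1) by (simp add: descent_def)
      have "\<phi> v < x"
      proof (rule stays_less[OF cont, of v Y])
        show "v \<le> Y" "\<phi> Y < x" using assms(3,5) Y \<phi>(2) m(2) by auto
        fix y assume y: "v \<le> y" "y \<le> Y"
        show "\<phi> y \<noteq> x"
        proof (cases "y < B t")
          case True
          then show ?thesis using not_x[OF \<phi>(1) _ y(1) True y(2)] m assms(2) by auto
        next
          case ny: False
          show ?thesis
          proof
            assume eq: "\<phi> y = x"
            then have "y < Y" using y \<phi>(2) m(2) assms(3) by (auto simp: order_le_less)
            \<comment> \<open>From \<open>B t\<close> up to \<open>Y\<close> the line at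
              \<open>x\<close> runs through \<open>t\<close>, so a square meeting it there has its
              top at \<open>B t\<close>; it would then contain a point of the column below
              \<open>t\<close>.\<close>
            obtain j where j: "j \<in> {1..m}" "L j \<le> x" "x \<le> R j" "B j \<le> y" "y \<le> T j"
              using descent_in_E[OF \<phi>(1), of y] y v eq by (auto simp: mem_E_iff)
            have jn: "j \<in> {1..n}" "j \<in> {1..i}" "j \<noteq> t" "s j > 0"
              using j m tn assms(2) sizes by auto
            have "T j \<le> B t"
              using disjoint[OF jn(1) tn(1) jn(3)] j jn assms(3,4) \<open>y < Y\<close> Y tn by auto
            then have "T j = B t" using j ny by auto
            then show False
              using column_avoids[OF col assms(5) jn(2) _ j(2)] j(3) by auto
          qed
        qed
      qed
      show False
        by (rule *[OF Y(1,2) cont]) (use \<phi> m(1,2) descent_in_E[OF \<phi>(1)] E_mono[of m t] \<open>\<phi> v < x\<close> in auto)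
    qed
  qed
  then show ?thesis ..
qed

section \<open>Covering the piece\<close>

lemma covered_generic:
  assumes u: "(x, v) \<in> U" and x: "x \<notin> L ` {1..i} \<union> R ` {1..i}"
  obtains k where "k \<in> {1..i}" "adjacent (sq (p k) (s k)) U"
    "B k \<le> v \<and> v \<le> T k \<and> R k \<le> x \<and> x \<le> R k + s k \<or>
     B k - s k \<le> v \<and> v \<le> B k \<and> L k \<le> x \<and> x \<le> R k + 2 * s k"
proof -
  obtain t where t: "t \<in> {1..i}" "L t \<le> x" "x \<le> R t" "v < B t"
    and col: "\<And>y. v \<le> y \<Longrightarrow> y < B t \<Longrightarrow> (x, y) \<in> U"
    using ex_above[OF u] by blast
  have "x \<noteq> L t" "x \<noteq> R t" using x t(1) by blast+
  then have t': "L t < x" "x < R t" using t by auto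
  have tn: "t \<in> {1..n}" "s t > 0" using t i sizes by auto
  have v: "0 \<le> v" using u U_avoids(1) by (auto simp: strip_def)
  obtain c where c: "c \<in> {1..<t}" "T c = B t" "L c < R t" "L t < R c"
    using ex_support[OF tn(1)] v t(4) by auto
  have "R c < x"
    using supports_left_of_column[OF u t(1) t' t(4) col c] .
  interpret column W s n p i t x v
  proof
    show "(x, y) \<notin> E i" if "v \<le> y" "y < B t" for y
      using col[OF that] U_avoids(1) by blast
    show "\<exists>c\<in>{1..i}. T c = B t \<and> L t < R c \<and> R c < x"
      using c \<open>R c < x\<close> t(1) by (intro bexI[of _ c]) auto
    show "\<exists>j\<in>{1..i}. R j < x \<and> B j \<le> y \<and> y \<le> T j" if "v \<le> y" "y < B t" for y
      using ex_left_square[OF col[OF that]] .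
  qed (use i t t' v in auto)
  have adj_t: "adjacent (sq (p t) (s t)) U"
  proof -
    have "closure ({x} \<times> {v..<B t}) \<subseteq> closure U"
      using col by (intro closure_mono) auto
    then have "(x, B t) \<in> closure U"
      using t(4) by (auto simp: closure_Times)
    moreover have "(x, B t) \<in> sq (p t) (s t)" using t tn by (auto simp: sq_def)
    ultimately show ?thesis unfolding adjacent_def by blast
  qed
  have adj_vis: "adjacent (sq (p k) (s k)) U" if "vis y k" for y k
  proof -
    note k = that[unfolded vis_def]
    \<comment> \<open>The row segment from the right side of \<open>k\<close> to the column is free,
      hence in \<open>U\<close> by maximality; its left end belongs to \<open>k\<close> and to the
      closure of \<open>U\<close>.\<close>
    have "(a, y) \<notin> E i" if "R k < a" "a \<le> x" for a
    proof
      assume "(a, y) \<in> E i"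
      then obtain j where j: "j \<in> {1..i}" "L j \<le> a" "a \<le> R j" "B j \<le> y" "y \<le> T j"
        by (auto simp: mem_E_iff)
      have "R j < x"
        using not_crossing[of j y] j k that by auto
      then have "R j \<le> R k"
        using k j genericD[of y j] that by auto
      then show False using j that by auto
    qed
    moreover have "0 \<le> R k" "x \<le> W"
      using k in_strip[of k] sizes[of k] in_n[of k] u U_avoids(1) by (auto simp: strip_def)
    ultimately have "{R k<..x} \<times> {y} \<subseteq> strip W - E i"
      using k v by (auto simp: strip_def)
    moreover have "{R k<..x} \<times> {y} \<inter> U \<noteq> {}"
      using k col[of y] by fastforce
    moreover have "connected ({R k<..x} \<times> {y})"
      by (intro connected_Times) auto
    ultimately have "{R k<..x} \<times> {y} \<subseteq> U"
      using U_maximal by blast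
    then have "closure ({R k<..x} \<times> {y}) \<subseteq> closure U"
      by (rule closure_mono)
    then have "(R k, y) \<in> closure U"
      using k by (auto simp: closure_Times)
    moreover have "(R k, y) \<in> sq (p k) (s k)"
      using k sizes[of k] in_n[of k] by (auto simp: sq_def)
    ultimately show ?thesis unfolding adjacent_def by blast
  qed
  show ?thesis
    using covered adj_t adj_vis that by metis
qed

end

theorem theorem10:
  fixes W :: real and s :: "nat \<Rightarrow> real" and n i :: nat and p :: "nat \<Rightarrow> point"
    and U :: "point set"
  assumes "W > 0"
    and "\<forall>k\<in>{1..n}. 0 < s k \<and> s k \<le> W"
    and "is_BL_packing W s n p"
    and "i \<in> {1..n}"
    and "U \<in> pieces W s p i"
    and "right_piece W U"
  shows "\<exists>T :: (nat \<times> point) set. finite T \<and>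
           (\<forall>(j, v)\<in>T. j \<in> {1..i} \<and> adjacent (sq (p j) (s j)) U) \<and>
           (\<forall>j. card {v. (j, v) \<in> T} \<le> 4) \<and>
           U \<subseteq> (\<Union>(j, v)\<in>T. (\<lambda>x. v + x) ` sq (p j) (s j))"
proof -
  interpret right_i_piece W s n p i U
    using assms by unfold_locales auto
  define V :: "nat \<Rightarrow> point set"
    where "V j = {(s j, 0), (0, - s j), (s j, - s j), (2 * s j, - s j)}" for j
  define \<T> where "\<T> = Sigma {j \<in> {1..i}. adjacent (sq (p j) (s j)) U} V"
  define M where "M = (\<Union>(j, v)\<in>\<T>. (\<lambda>x. v + x) ` sq (p j) (s j))"
  have fin: "finite \<T>"
    unfolding \<T>_def by (intro finite_SigmaI) (auto simp: V_def)
  have card: "card {v. (j, v) \<in> \<T>} \<le> 4" for j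
  proof -
    have "card {v. (j, v) \<in> \<T>} \<le> card (V j)"
      by (intro card_mono) (auto simp: \<T>_def V_def)
    also have "\<dots> \<le> 4"
      unfolding V_def by (intro card_insert_le_m1) auto
    finally show ?thesis .
  qed
  have "closed M"
    unfolding M_def sq_def using fin by (intro closed_UN) (auto intro!: closed_translation closed_Times)
  have translate: "(x, v) \<in> (\<lambda>z. (a, b) + z) ` sq q r \<longleftrightarrow>
      fst q + a \<le> x \<and> x \<le> fst q + r + a \<and> snd q + b \<le> v \<and> v \<le> snd q + r + b" for x v a b q r
  proof -
    have "(x, v) \<in> (\<lambda>z. (a, b) + z) ` sq q r \<longleftrightarrow> (x - a, v - b) \<in> sq q r"
      by (force simp: image_iff)
    then show ?thesis by (auto simp: sq_def)
  qed
  have "U \<subseteq> M"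
  proof
    fix u assume "u \<in> U"
    show "u \<in> M"
    proof (rule ccontr)
      assume "u \<notin> M"
      \<comment> \<open>\<open>M\<close> is closed, so an uncovered point would have uncovered
        neighbours in \<open>U\<close> off all vertical sides, where the covering is already
        known.\<close>
      then obtain e where e: "e > 0" "ball u e \<subseteq> - M"
        using \<open>closed M\<close> open_contains_ball by (metis ComplI open_Compl)
      obtain a where a: "a \<notin> L ` {1..i} \<union> R ` {1..i}" "\<bar>a - fst u\<bar> < e" "(a, snd u) \<in> U"
        using ex_in_U_avoiding[OF \<open>u \<in> U\<close> _ e(1), of "L ` {1..i} \<union> R ` {1..i}"] by blast
      obtain k where k: "k \<in> {1..i}" "adjacent (sq (p k) (s k)) U"
        "B k \<le> snd u \<and> snd u \<le> T k \<and> R k \<le> a \<and> a \<le> R k + s k \<or>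
         B k - s k \<le> snd u \<and> snd u \<le> B k \<and> L k \<le> a \<and> a \<le> R k + 2 * s k"
        using covered_generic[OF a(3,1)] by blast
      have "\<exists>w\<in>V k. (a, snd u) \<in> (\<lambda>z. w + z) ` sq (p k) (s k)"
        unfolding V_def bex_simps translate using k(3) by auto
      then have "(a, snd u) \<in> M"
        using k(1,2) by (auto simp: M_def \<T>_def)
      moreover have "dist u (a, snd u) < e"
        using a(2) by (cases u) (simp add: dist_prod_def dist_real_def)
      ultimately show False using e(2) by auto
    qed
  qed
  then show ?thesis
    using fin card by (intro exI[of _ \<T>]) (auto simp: \<T>_def M_def)
qed

end
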